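(* Let $A\in\mathbb{R}^{m\times n}$ and let $C\subseteq\mathbb{R}^n$, $D\subseteq\mathbb{R}^m$ be nonempty closed sets (possibly nonconvex) with $C^\infty\cap A^{-1}D^\infty=\{0\}$. Let $\{x^t\}$ be a sequence generated by the algorithm $\mathsf{SpFeas}_{\mathrm{DC}_{\mathsf{ls}}}$ described in the context. Then the following statements hold: (i) The sequence $\{x^t\}$ is bounded. (ii) Any accumulation point of $\{x^t\}$ is a stationary point of the split feasibility problem of finding $x\in C$ with $Ax\in D$, i.e., any accumulation point $x^*$ satisfies $$0\in A^TAx^*-A^T\mathrm{Proj}_D(Ax^* )+N_C(x^* ).$$
   Context: Notation. $\|\cdot\|$ is the Euclidean norm. For a nonempty closed set $S$: $d(x,S)=\inf_{u\in S}\|x-u\|$; $\mathrm{Proj}_S(x)=\mathrm{Argmin}_{y\in S}\|y-x\|$ (a nonempty set, not necessarily a singleton); the horizon cone is $S^\infty=\{x:\ \exists\, x^t\in S,\ \beta_t\downarrow 0 \text{ with } \beta_t x^t\to x\}$; $A^{-1}D^\infty=\{x\in\mathbb{R}^n: Ax\in D^\infty\}$. For a proper lower semicontinuous $f:\mathbb{R}^n\to(-\infty,\infty]$ and $\bar x\in\mathrm{dom} f$, the regular subdifferential is $\hat\partial f(\bar x)=\{v:\liminf_{x\to\bar x,x\ne\bar x}\frac{f(x)-f(\bar x)-\langle v,x-\bar x\rangle}{\|x-\bar x\|}\ge 0\}$ and the (limiting) subdifferential is $\partial f(\bar x)=\{v:\exists\, x^t\to\bar x \text{ with } f(x^t)\to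 f(\bar x),\ v^t\to v,\ v^t\in\hat\partial f(x^t)\ \forall t\}$; both are empty outside $\mathrm{dom} f$. The limiting normal cone is $N_C(x)=\partial\delta_C(x)$, where $\delta_C$ is the indicator function ($0$ on $C$, $+\infty$ elsewhere). Set-valued expressions use Minkowski sums; the stationarity inclusion means there is $\eta^*\in\mathrm{Proj}_D(Ax^* )$ with $0\in A^TAx^*-A^T\eta^*+N_C(x^* )$. Algorithm $\mathsf{SpFeas}_{\mathrm{DC}_{\mathsf{ls}}}$ (run without termination, so that it generates an infinite sequence). Step 0. Choose $x^0\in C$, $L_{\max}\ge L_{\min}>0$, $\tau>1$, $c>0$ and an integer $M\ge 0$. Set $t=0$. Step 1. Choose any $L_t^0\in[L_{\min},L_{\max}]$ and set $L_t=L_t^0$. 1a) Pick any $\eta^t\in\mathrm{Proj}_D(Ax^t)$ and find $u\in\mathrm{Proj}_C\left(x^t-\frac{A^T(Ax^t-\eta^t)}{L_t}\right)$. 1b) If $d^2(Au,D)\le\max_{[t-M]_+\le i\le t}d^2(Ax^i,D)-c\|u-x^t\|^2$, where $[a]_+=\max\{a,0\}$, go to Step 2. 1c) Set $L_t\leftarrow\tau L_t$ and go to Step 1a). Step 2. Set $\bar L_t=L_t$, $x^{t+1}=u$, $t\leftarrow t+1$ and go to Step 1. *)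

theory Defs
  imports "HOL-Analysis.Analysis"
begin

text \<open>Unlike \<^const>\<open>closest_point\<close>, which selects one minimiser, this is the full set of minimisers.\<close>

definition proj_set :: "'a::real_normed_vector set \<Rightarrow> 'a \<Rightarrow> 'a set" where
  "proj_set S x = {y. is_arg_min (\<lambda>y. norm (y - x)) (\<lambda>y. y \<in> S) y}"

definition horizon_cone :: "'a::real_normed_vector set \<Rightarrow> 'a set" where
  "horizon_cone S = {x. \<exists>(xs :: nat \<Rightarrow> 'a) (\<beta> :: nat \<Rightarrow> real).
     (\<forall>t. xs t \<in> S) \<and> (\<forall>t. 0 < \<beta> t) \<and> \<beta> \<longlonglongrightarrow> 0 \<and> (\<lambda>t. \<beta> t *\<^sub>R xs t) \<longlonglongrightarrow> x}"

text \<open>Extended-real-valued functions are meant to be proper (nowhere \<open>-\<infinity>\<close>), so the effective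
  domain is where the value is \<open>< \<infinity>\<close>. The filter \<open>at a\<close> excludes \<open>a\<close> itself, so the quotients
  below never have denominator \<open>0\<close>; where \<open>f x = \<infinity>\<close> the quotient is \<open>\<infinity>\<close>.\<close>

definition regular_subdifferential :: "('a::real_inner \<Rightarrow> ereal) \<Rightarrow> 'a \<Rightarrow> 'a set" where
  "regular_subdifferential f a = {v. f a < \<infinity> \<and>
     Liminf (at a) (\<lambda>x. (f x - f a - ereal (v \<bullet> (x - a))) / ereal (norm (x - a))) \<ge> 0}"

definition limiting_subdifferential :: "('a::real_inner \<Rightarrow> ereal) \<Rightarrow> 'a \<Rightarrow> 'a set" where
  "limiting_subdifferential f a = {v. f a < \<infinity> \<and>
     (\<exists>(xs :: nat \<Rightarrow> 'a) (vs :: nat \<Rightarrow> 'a).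
        xs \<longlonglongrightarrow> a \<and> (\<lambda>t. f (xs t)) \<longlonglongrightarrow> f a \<and> vs \<longlonglongrightarrow> v \<and>
        (\<forall>t. vs t \<in> regular_subdifferential f (xs t)))}"

definition indicator_fun :: "'a set \<Rightarrow> 'a \<Rightarrow> ereal" where
  "indicator_fun C x = (if x \<in> C then 0 else \<infinity>)"

definition limiting_normal_cone :: "'a::real_inner set \<Rightarrow> 'a \<Rightarrow> 'a set" where
  "limiting_normal_cone C x = limiting_subdifferential (indicator_fun C) x"

definition sf_stationary ::
  "real ^ 'n ^ 'm \<Rightarrow> (real ^ 'n) set \<Rightarrow> (real ^ 'm) set \<Rightarrow> real ^ 'n \<Rightarrow> bool" where
  "sf_stationary A C D x \<longleftrightarrow>
     (\<exists>\<eta> \<in> proj_set D (A *v x). \<exists>w \<in> limiting_normal_cone C x.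
        0 = transpose A *v (A *v x) - transpose A *v \<eta> + w)"

text \<open>One run of the backtracking loop at the iterate \<open>y\<close> with reference value \<open>R\<close>:
  \<open>sf_line_search A C D \<tau> c R y L L' u\<close> says that, started with the trial constant \<open>L\<close>, the loop
  can stop with the constant \<open>L'\<close> and the accepted point \<open>u\<close>. The point \<open>\<eta>\<close> is chosen anew in every
  trial.\<close>

inductive sf_line_search ::
  "real ^ 'n ^ 'm \<Rightarrow> (real ^ 'n) set \<Rightarrow> (real ^ 'm) set \<Rightarrow> real \<Rightarrow> real \<Rightarrow> real \<Rightarrow> real ^ 'n
     \<Rightarrow> real \<Rightarrow> real \<Rightarrow> real ^ 'n \<Rightarrow> bool"
  for A C D \<tau> c R y where
  accept: "sf_line_search A C D \<tau> c R y L L u"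
    if "\<eta> \<in> proj_set D (A *v y)"
      and "u \<in> proj_set C (y - (transpose A *v (A *v y - \<eta>)) /\<^sub>R L)"
      and "(infdist (A *v u) D)\<^sup>2 \<le> R - c * (norm (u - y))\<^sup>2"
| reject: "sf_line_search A C D \<tau> c R y L L' u'"
    if "\<eta> \<in> proj_set D (A *v y)"
      and "u \<in> proj_set C (y - (transpose A *v (A *v y - \<eta>)) /\<^sub>R L)"
      and "\<not> (infdist (A *v u) D)\<^sup>2 \<le> R - c * (norm (u - y))\<^sup>2"
      and "sf_line_search A C D \<tau> c R y (\<tau> * L) L' u'"

text \<open>The subtraction \<open>t - M\<close> is truncated at \<open>0\<close>, as intended.\<close>

definition spfeas_dc_ls ::
  "real ^ 'n ^ 'm \<Rightarrow> (real ^ 'n) set \<Rightarrow> (real ^ 'm) set \<Rightarrow> real \<Rightarrow> real \<Rightarrow> real \<Rightarrow> real \<Rightarrow> nat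
     \<Rightarrow> (nat \<Rightarrow> real ^ 'n) \<Rightarrow> bool" where
  "spfeas_dc_ls A C D Lmin Lmax \<tau> c M x \<longleftrightarrow> x 0 \<in> C \<and>
     (\<forall>t. \<exists>L0 \<in> {Lmin..Lmax}. \<exists>Lbar.
        sf_line_search A C D \<tau> c (Max ((\<lambda>i. (infdist (A *v x i) D)\<^sup>2) ` {t - M..t}))
          (x t) L0 Lbar (x (Suc t)))"

end

theory Submission
  imports Defs
begin

text \<open>
  Write \<open>F z = (infdist (A *v z) D)\<^sup>2\<close>. Since \<open>F\<close> is a minimum of the quadratics
  \<open>z \<mapsto> (norm (A *v z - \<eta>))\<^sup>2\<close> over \<open>\<eta> \<in> D\<close>, the quadratic belonging to the projection \<open>\<eta>\<close> of
  \<open>A *v y\<close> majorises \<open>F\<close> and touches it at \<open>y\<close>. A projected gradient step of length \<open>1 / L\<close> on that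
  quadratic decreases \<open>F\<close> by at least \<open>(L - (onorm ((*v) A))\<^sup>2) * (norm (u - y))\<^sup>2\<close>
  (\<open>projected_step_decrease\<close>). Hence every trial constant above \<open>(onorm ((*v) A))\<^sup>2 + c\<close> is accepted, and
  the accepted constants are bounded uniformly in the iteration (\<open>line_search_outcome\<close>).

  Acceptance never lets \<open>F\<close> exceed the maximum of its last \<open>M + 1\<close> values, so all iterates lie in the
  sublevel set of \<open>F\<close> on \<open>C\<close> through the starting point. An unbounded sequence in such a set would,
  after normalisation, have a unit limit direction in \<open>horizon_cone C\<close> whose image lies in
  \<open>horizon_cone D\<close> (\<open>bounded_sublevel_if_horizon_cones\<close>). This gives boundedness.

  On the bounded set of iterates \<open>F\<close> is Lipschitz, and a nonmonotone descent argument of Grippo,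
  Lampariello and Lucidi shows that consecutive iterates become arbitrarily close
  (\<open>nonmonotone_descent_steps_tendsto_0\<close>). Near an accumulation point \<open>x\<^sup>*\<close> the optimality of the
  projection onto \<open>C\<close> says that \<open>L *\<^sub>R (x\<^sub>t - x\<^sub>t\<^sub>+\<^sub>1) - transpose A *v (A *v x\<^sub>t - \<eta>\<^sub>t)\<close> is a regular normal
  to \<open>C\<close> at \<open>x\<^sub>t\<^sub>+\<^sub>1\<close>. The first summand vanishes in the limit because \<open>L\<close> stays bounded, and the
  projections \<open>\<eta>\<^sub>t\<close> accumulate at a projection of \<open>A *v x\<^sup>*\<close>; this is the stationarity inclusion.
\<close>

section \<open>Projections and normal vectors\<close>

lemma proj_set_iff:
  "y \<in> proj_set S x \<longleftrightarrow> y \<in> S \<and> (\<forall>s\<in>S. norm (y - x) \<le> norm (s - x))"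
  by (auto simp: proj_set_def is_arg_min_def not_less)

lemma infdist_eq_norm_proj_set:
  assumes "y \<in> proj_set S x"
  shows "infdist x S = norm (x - y)"
proof (rule antisym)
  show "infdist x S \<le> norm (x - y)"
    using assms infdist_le[of y S x] by (auto simp: proj_set_iff dist_norm)
  have "norm (x - y) \<le> dist x s" if "s \<in> S" for s
    using assms that by (simp add: proj_set_iff dist_norm norm_minus_commute)
  moreover have "S \<noteq> {}"
    using assms by (auto simp: proj_set_iff)
  ultimately show "norm (x - y) \<le> infdist x S"
    by (auto simp: infdist_notempty intro!: cINF_greatest)
qed

lemma proj_set_closed_graph:
  assumes "closed S" "\<And>k. y k \<in> proj_set S (x k)" "x \<longlonglongrightarrow> a" "y \<longlonglongrightarrow> b"
  shows "b \<in> proj_set S a"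
proof -
  have "b \<in> S"
    using assms by (intro closed_sequentially[of S y b]) (auto simp: proj_set_iff)
  moreover have "norm (b - a) \<le> norm (s - a)" if "s \<in> S" for s
  proof (rule LIMSEQ_le)
    show "(\<lambda>k. norm (y k - x k)) \<longlonglongrightarrow> norm (b - a)" "(\<lambda>k. norm (s - x k)) \<longlonglongrightarrow> norm (s - a)"
      using assms by (auto intro!: tendsto_intros)
    show "\<exists>N. \<forall>k\<ge>N. norm (y k - x k) \<le> norm (s - x k)"
      using assms that by (auto simp: proj_set_iff)
  qed
  ultimately show ?thesis by (simp add: proj_set_iff)
qed

text \<open>Expanding \<open>norm (s - z) \<ge> norm (u - z)\<close> around \<open>u\<close> leaves a quadratic error term.\<close>

lemma proj_set_inner_le:
  fixes z :: "'a::real_inner"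
  assumes "u \<in> proj_set S z" "s \<in> S"
  shows "2 * ((z - u) \<bullet> (s - u)) \<le> (norm (s - u))\<^sup>2"
proof -
  have "(norm (u - z))\<^sup>2 \<le> (norm (s - z))\<^sup>2"
    using assms by (simp add: proj_set_iff)
  then show ?thesis
    by (simp add: power2_norm_eq_inner inner_diff_left inner_diff_right inner_commute)
qed

text \<open>Proximal normals are regular normals: the error term above is quadratic in the distance to \<open>u\<close>,
  hence negligible after division by that distance.\<close>

lemma proximal_normal_in_regular_subdifferential:
  fixes z :: "'a::euclidean_space"
  assumes u: "u \<in> proj_set S z" and "0 \<le> L"
  shows "L *\<^sub>R (z - u) \<in> regular_subdifferential (indicator_fun S) u"
proof -
  let ?q = "\<lambda>s. (indicator_fun S s - indicator_fun S u - ereal ((L *\<^sub>R (z - u)) \<bullet> (s - u)))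
                 / ereal (norm (s - u))"
  have uS: "u \<in> S" using u by (simp add: proj_set_iff)
  have lower: "ereal (- (L / 2 * norm (s - u))) \<le> ?q s" if "s \<noteq> u" for s
  proof (cases "s \<in> S")
    case True
    have "L * (2 * ((z - u) \<bullet> (s - u))) \<le> L * (norm (s - u))\<^sup>2"
      using proj_set_inner_le[OF u True] \<open>0 \<le> L\<close> by (rule mult_left_mono)
    then have "- (L / 2 * norm (s - u)) \<le> - (L * ((z - u) \<bullet> (s - u))) / norm (s - u)"
      using that by (simp add: field_simps power2_eq_square)
    then show ?thesis using True uS that by (simp add: indicator_fun_def)
  next
    case False
    then show ?thesis using uS that by (simp add: indicator_fun_def)
  qed
  have "((\<lambda>s. - (L / 2 * norm (s - u))) \<longlongrightarrow> - (L / 2 * norm (u - u))) (at u)"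
    by (intro tendsto_intros)
  then have "((\<lambda>s. ereal (- (L / 2 * norm (s - u)))) \<longlongrightarrow> 0) (at u)"
    by (simp add: zero_ereal_def)
  then have "0 = Liminf (at u) (\<lambda>s. ereal (- (L / 2 * norm (s - u))))"
    by (intro lim_imp_Liminf[symmetric]) auto
  also have "\<dots> \<le> Liminf (at u) ?q"
    by (rule Liminf_mono) (use lower in \<open>auto simp: eventually_at_filter\<close>)
  finally show ?thesis
    using uS by (simp add: regular_subdifferential_def indicator_fun_def)
qed

section \<open>Boundedness of sublevel sets\<close>

text \<open>A sequence escaping to infinity in the set has, after division by its norms, a limit direction
  of norm 1. Points of \<open>D\<close> within the fixed distance \<open>r\<close> of the images have the same limit after this
  scaling, so the direction violates the hypothesis on the horizon cones.\<close>

lemma bounded_sublevel_if_horizon_cones: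
  fixes f :: "'a::euclidean_space \<Rightarrow> 'b::euclidean_space"
  assumes f: "bounded_linear f" and D: "closed D" "D \<noteq> {}"
    and cones: "horizon_cone C \<inter> f -` horizon_cone D \<subseteq> {0}"
  shows "bounded {z \<in> C. infdist (f z) D \<le> r}" (is "bounded ?S")
proof (rule ccontr)
  assume "\<not> bounded ?S"
  then have "\<exists>z\<in>?S. real (Suc k) < norm z" for k
    unfolding bounded_iff by (meson not_le)
  then obtain z where z: "\<And>k. z k \<in> ?S" "\<And>k. real (Suc k) < norm (z k)"
    by metis
  have "\<exists>y\<in>D. dist (f (z k)) y \<le> r" for k
    using infdist_attains_inf[OF D] z(1)[of k] by (metis (mono_tags, lifting) mem_Collect_eq)
  then obtain y where y: "\<And>k. y k \<in> D" "\<And>k. dist (f (z k)) (y k) \<le> r"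
    by metis
  have z0: "norm (z k) > 0" for k
    using z(2)[of k] by (meson of_nat_0_le_iff le_less_trans)
  have "bounded (range (\<lambda>k. z k /\<^sub>R norm (z k)))"
    using z0 by (auto simp: bounded_iff intro!: exI[of _ 1])
  then obtain d g where g: "strict_mono g" and d: "((\<lambda>k. z k /\<^sub>R norm (z k)) \<circ> g) \<longlonglongrightarrow> d"
    using bounded_imp_convergent_subsequence by blast
  define \<beta> where "\<beta> k = inverse (norm (z (g k)))" for k
  have \<beta>pos: "0 < \<beta> k" for k
    using z0 by (simp add: \<beta>_def)
  have "\<beta> \<longlonglongrightarrow> 0"
  proof (rule real_tendsto_sandwich[OF _ _ tendsto_const LIMSEQ_inverse_real_of_nat])
    have "\<beta> k \<le> inverse (real (Suc k))" for k
    proof -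
      have "real (Suc k) \<le> real (Suc (g k))"
        using seq_suble[OF g] by simp
      also have "\<dots> \<le> norm (z (g k))" using z(2) less_imp_le by blast
      finally show ?thesis unfolding \<beta>_def by (intro le_imp_inverse_le) auto
    qed
    then show "\<forall>\<^sub>F k in sequentially. \<beta> k \<le> inverse (real (Suc k))" by simp
    show "\<forall>\<^sub>F k in sequentially. 0 \<le> \<beta> k" using \<beta>pos less_imp_le by (auto intro!: always_eventually)
  qed
  have zlim: "(\<lambda>k. \<beta> k *\<^sub>R z (g k)) \<longlonglongrightarrow> d"
    using d by (simp add: \<beta>_def o_def)
  then have dC: "d \<in> horizon_cone C"
    using \<beta>pos \<open>\<beta> \<longlonglongrightarrow> 0\<close> z(1) unfolding horizon_cone_def
    by (auto intro!: exI[of _ "\<lambda>k. z (g k)"] exI[of _ \<beta>])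
  have "(\<lambda>k. f (\<beta> k *\<^sub>R z (g k))) \<longlonglongrightarrow> f d"
    using bounded_linear.tendsto[OF f zlim] .
  moreover have "(\<lambda>k. \<beta> k *\<^sub>R (f (z (g k)) - y (g k))) \<longlonglongrightarrow> 0"
  proof (rule Lim_null_comparison)
    show "\<forall>\<^sub>F k in sequentially. norm (\<beta> k *\<^sub>R (f (z (g k)) - y (g k))) \<le> \<beta> k * r"
      using y(2) \<beta>pos by (auto simp: dist_norm less_imp_le intro!: always_eventually mult_left_mono)
    show "(\<lambda>k. \<beta> k * r) \<longlonglongrightarrow> 0" using \<open>\<beta> \<longlonglongrightarrow> 0\<close> tendsto_mult_left_zero by blast
  qed
  ultimately have "(\<lambda>k. f (\<beta> k *\<^sub>R z (g k)) - \<beta> k *\<^sub>R (f (z (g k)) - y (g k))) \<longlonglongrightarrow> f d - 0"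
    by (rule tendsto_diff)
  then have "(\<lambda>k. \<beta> k *\<^sub>R y (g k)) \<longlonglongrightarrow> f d"
    by (simp add: linear_scale[OF bounded_linear.linear[OF f]] algebra_simps)
  then have "f d \<in> horizon_cone D"
    using \<beta>pos \<open>\<beta> \<longlonglongrightarrow> 0\<close> y(1) unfolding horizon_cone_def
    by (auto intro!: exI[of _ "\<lambda>k. y (g k)"] exI[of _ \<beta>])
  then have "d = 0" using dC cones by auto
  moreover have "norm d = 1"
  proof (rule LIMSEQ_unique)
    show "(\<lambda>k. norm (\<beta> k *\<^sub>R z (g k))) \<longlonglongrightarrow> norm d" using zlim by (rule tendsto_norm)
    have "norm (\<beta> k *\<^sub>R z (g k)) = 1" for k using z0[of "g k"] by (simp add: \<beta>_def)
    then show "(\<lambda>k. norm (\<beta> k *\<^sub>R z (g k))) \<longlonglongrightarrow> 1" by simp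
  qed
  ultimately show False by simp
qed

section \<open>Sufficient decrease and the line search\<close>

text \<open>For \<open>g = transpose A *v (A *v y - \<eta>)\<close>, the minimising property of \<open>u\<close> compared with \<open>y \<in> C\<close> reads
  \<open>2 * (g \<bullet> (u - y)) \<le> - L * (norm (u - y))\<^sup>2\<close>. Inserting this into the expansion of
  \<open>(norm (A *v u - \<eta>))\<^sup>2\<close>, an upper bound for the squared distance at \<open>u\<close>, gives the decrease.\<close>

lemma projected_step_decrease:
  fixes A :: "real ^ 'n ^ 'm"
  assumes \<eta>: "\<eta> \<in> proj_set D (A *v y)" and "y \<in> C" "0 < L"
    and u: "u \<in> proj_set C (y - (transpose A *v (A *v y - \<eta>)) /\<^sub>R L)"
  shows "(infdist (A *v u) D)\<^sup>2
    \<le> (infdist (A *v y) D)\<^sup>2 - (L - (onorm ((*v) A))\<^sup>2) * (norm (u - y))\<^sup>2"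
proof -
  define g where "g = transpose A *v (A *v y - \<eta>)"
  have g: "g \<bullet> v = (A *v y - \<eta>) \<bullet> (A *v v)" for v
    by (simp add: g_def transpose_matrix_vector dot_lmul_matrix)
  have "2 * ((y - g /\<^sub>R L - u) \<bullet> (y - u)) \<le> (norm (y - u))\<^sup>2"
    using proj_set_inner_le[OF u \<open>y \<in> C\<close>] by (simp add: g_def)
  then have "(norm (u - y))\<^sup>2 + 2 * (g \<bullet> (u - y)) / L \<le> 0"
    by (simp add: power2_norm_eq_inner inner_diff_left inner_diff_right inner_commute
        divide_inverse algebra_simps)
  then have step: "2 * (g \<bullet> (u - y)) \<le> - L * (norm (u - y))\<^sup>2"
    using \<open>0 < L\<close> by (simp add: field_simps)
  have "norm (A *v (u - y)) \<le> onorm ((*v) A) * norm (u - y)"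
    by (rule onorm) (rule matrix_vector_mul_bounded_linear)
  then have quad: "(norm (A *v (u - y)))\<^sup>2 \<le> (onorm ((*v) A))\<^sup>2 * (norm (u - y))\<^sup>2"
    by (metis power_mono norm_ge_zero power_mult_distrib)
  have "infdist (A *v u) D \<le> norm (A *v u - \<eta>)"
    using \<eta> infdist_le[of \<eta> D "A *v u"] by (auto simp: proj_set_iff dist_norm)
  then have "(infdist (A *v u) D)\<^sup>2 \<le> (norm (A *v u - \<eta>))\<^sup>2"
    by (simp add: power_mono infdist_nonneg)
  also have "A *v u - \<eta> = (A *v y - \<eta>) + A *v (u - y)"
    by (simp add: matrix_vector_mult_diff_distrib)
  also have "(norm \<dots>)\<^sup>2 = (norm (A *v y - \<eta>))\<^sup>2 + 2 * (g \<bullet> (u - y)) + (norm (A *v (u - y)))\<^sup>2"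
    unfolding g by (simp add: power2_norm_eq_inner inner_add_left inner_add_right inner_commute)
  also have "norm (A *v y - \<eta>) = infdist (A *v y) D"
    using infdist_eq_norm_proj_set[OF \<eta>] by simp
  finally show ?thesis
    using step quad by (simp add: algebra_simps)
qed

text \<open>A rejected constant lies below \<open>(onorm ((*v) A))\<^sup>2 + c\<close> by the decrease estimate, so the constant
  tried next exceeds this threshold at most by the factor \<open>\<tau>\<close>.\<close>

lemma line_search_outcome:
  fixes A :: "real ^ 'n ^ 'm"
  assumes "sf_line_search A C D \<tau> c R y L L' u"
    and "y \<in> C" "(infdist (A *v y) D)\<^sup>2 \<le> R" "0 < L" "1 < \<tau>"
  shows "0 < L' \<and> L' \<le> max L (\<tau> * ((onorm ((*v) A))\<^sup>2 + c)) \<and>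
    (infdist (A *v u) D)\<^sup>2 \<le> R - c * (norm (u - y))\<^sup>2 \<and>
    (\<exists>\<eta>\<in>proj_set D (A *v y). u \<in> proj_set C (y - (transpose A *v (A *v y - \<eta>)) /\<^sub>R L'))"
  using assms
proof (induction rule: sf_line_search.induct)
  case (accept \<eta> u L)
  then show ?case by auto
next
  case (reject \<eta> u L L' u')
  have "L < (onorm ((*v) A))\<^sup>2 + c"
  proof (rule ccontr)
    assume "\<not> L < (onorm ((*v) A))\<^sup>2 + c"
    then have "c * (norm (u - y))\<^sup>2 \<le> (L - (onorm ((*v) A))\<^sup>2) * (norm (u - y))\<^sup>2"
      by (intro mult_right_mono) auto
    moreover have "(infdist (A *v u) D)\<^sup>2
        \<le> (infdist (A *v y) D)\<^sup>2 - (L - (onorm ((*v) A))\<^sup>2) * (norm (u - y))\<^sup>2"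
      using reject by (intro projected_step_decrease)
    ultimately show False
      using reject by linarith
  qed
  then have "\<tau> * L \<le> \<tau> * ((onorm ((*v) A))\<^sup>2 + c)"
    using reject by simp
  moreover have "0 < \<tau> * L" using reject by simp
  ultimately show ?case using reject by auto
qed

section \<open>Nonmonotone descent\<close>

lemma nonmonotone_window_max_decseq:
  fixes a :: "nat \<Rightarrow> real"
  assumes "\<And>t. a (Suc t) \<le> Max (a ` {t - M..t})"
  shows "decseq (\<lambda>t. Max (a ` {t - M..t}))"
proof (rule decseq_SucI)
  fix t
  have "a i \<le> Max (a ` {t - M..t})" if "i \<in> {Suc t - M..Suc t}" for i
  proof (cases "i = Suc t")
    case False
    then show ?thesis using that by (intro Max_ge) auto
  qed (use assms in simp)
  then show "Max (a ` {Suc t - M..Suc t}) \<le> Max (a ` {t - M..t})"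
    by (intro Max.boundedI) auto
qed

text \<open>The window maxima decrease to a limit \<open>w\<close>. Let \<open>s t\<close> be an index in \<open>{t + 1..t + 1 + M}\<close> where
  the maximum of that window is attained, so that \<open>a (s t)\<close> tends to \<open>w\<close>. If \<open>a (s t - j)\<close> tends to
  \<open>w\<close>, then the step leading to the index \<open>s t - j\<close> tends to 0, since \<open>c\<close> times its square is at most
  the gap between the preceding window maximum and the value at this index, and both tend to \<open>w\<close>; by
  the Lipschitz bound \<open>a (s t - Suc j)\<close> tends to \<open>w\<close> as well. As \<open>t\<close> is one of the finitely many indices \<open>s t - j\<close> with \<open>j \<le> Suc M\<close>, the
  whole sequence \<open>a\<close> tends to \<open>w\<close>.\<close>

lemma nonmonotone_descent_steps_tendsto_0:
  fixes a d :: "nat \<Rightarrow> real"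
  assumes "0 < c" and a0: "\<And>t. 0 \<le> a t"
    and lip: "\<And>t. \<bar>a (Suc t) - a t\<bar> \<le> B * d t"
    and descent: "\<And>t. a (Suc t) \<le> Max (a ` {t - M..t}) - c * (d t)\<^sup>2"
  shows "d \<longlonglongrightarrow> 0"
proof -
  define W where "W t = Max (a ` {t - M..t})" for t
  have "decseq W"
    unfolding W_def
  proof (rule nonmonotone_window_max_decseq)
    show "a (Suc t) \<le> Max (a ` {t - M..t})" for t
      by (rule order_trans[OF descent]) (use \<open>0 < c\<close> in simp)
  qed
  moreover have "0 \<le> W t" for t
    unfolding W_def using a0[of t] by (rule order_trans) (auto intro!: Max_ge)
  ultimately obtain w where w: "W \<longlonglongrightarrow> w"
    using decseq_convergent by metis
  have small_steps: "(\<lambda>k. d (p k)) \<longlonglongrightarrow> 0"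
    if p: "filterlim p at_top sequentially" and a: "(\<lambda>k. a (Suc (p k))) \<longlonglongrightarrow> w" for p
  proof -
    have "(\<lambda>k. (W (p k) - a (Suc (p k))) / c) \<longlonglongrightarrow> (w - w) / c"
      using \<open>0 < c\<close> by (intro tendsto_intros a filterlim_compose[OF w p]) auto
    then have lim: "(\<lambda>k. (W (p k) - a (Suc (p k))) / c) \<longlonglongrightarrow> 0" by simp
    have "(\<lambda>k. (d (p k))\<^sup>2) \<longlonglongrightarrow> 0"
      by (rule Lim_null_comparison[OF _ lim])
         (use descent \<open>0 < c\<close> in \<open>auto simp: W_def field_simps intro!: always_eventually\<close>)
    then show ?thesis by simp
  qed
  have "\<exists>s. s \<in> {Suc t..Suc t + M} \<and> a s = W (Suc t + M)" for t
  proof -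
    have "W (Suc t + M) \<in> a ` {Suc t..Suc t + M}"
      unfolding W_def diff_add_inverse2 by (rule Max_in) auto
    then show ?thesis by (metis imageE)
  qed
  then obtain s where s: "\<And>t. s t \<in> {Suc t..Suc t + M}" "\<And>t. a (s t) = W (Suc t + M)"
    by metis
  have s_lim: "filterlim (\<lambda>t. s t - j) at_top sequentially" for j
  proof (rule filterlim_at_top_mono)
    show "filterlim (\<lambda>t. t - j) at_top sequentially" by (rule filterlim_minus_const_nat_at_top)
    show "\<forall>\<^sub>F t in sequentially. t - j \<le> s t - j"
      using s(1) by (intro always_eventually allI diff_le_mono) (simp add: Suc_leD)
  qed
  have offset_lim: "(\<lambda>t. a (s t - j)) \<longlonglongrightarrow> w" for j
  proof (induction j)
    case 0
    have "(\<lambda>t. W (t + Suc M)) \<longlonglongrightarrow> w" using w by (rule LIMSEQ_ignore_initial_segment)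
    then show ?case by (simp add: s(2))
  next
    case (Suc j)
    let ?p = "\<lambda>t. s t - Suc j"
    (* For t < j the truncated subtraction breaks this identity. *)
    have "\<forall>\<^sub>F t in sequentially. s t - j = Suc (?p t)"
      using eventually_ge_at_top[of j]
    proof eventually_elim
      case (elim t)
      then show ?case using s(1)[of t] by auto
    qed
    then have "\<forall>\<^sub>F t in sequentially. a (s t - j) = a (Suc (?p t))"
      by eventually_elim simp
    with Suc have lim: "(\<lambda>t. a (Suc (?p t))) \<longlonglongrightarrow> w"
      by (rule Lim_transform_eventually)
    have "(\<lambda>t. B * d (?p t)) \<longlonglongrightarrow> 0"
      using small_steps[OF s_lim lim] tendsto_mult_right_zero by blast
    then have "(\<lambda>t. a (Suc (?p t)) - a (?p t)) \<longlonglongrightarrow> 0"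
      by (rule Lim_null_comparison[rotated]) (use lip in \<open>auto intro!: always_eventually\<close>)
    from tendsto_diff[OF lim this] show ?case by simp
  qed
  have sum: "(\<lambda>t. \<Sum>j\<le>Suc M. \<bar>a (s t - j) - w\<bar>) \<longlonglongrightarrow> 0"
    by (intro tendsto_null_sum) (use offset_lim in \<open>auto intro!: tendsto_rabs_zero simp: LIM_zero_iff\<close>)
  have "(\<lambda>t. a t - w) \<longlonglongrightarrow> 0"
  proof (rule Lim_null_comparison[OF always_eventually[OF allI] sum])
    fix t
    have "\<bar>a (s t - (s t - t)) - w\<bar> \<le> (\<Sum>j\<le>Suc M. \<bar>a (s t - j) - w\<bar>)"
      using s(1)[of t] by (intro member_le_sum[of "s t - t" _ "\<lambda>j. \<bar>a (s t - j) - w\<bar>"]) auto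
    then show "norm (a t - w) \<le> (\<Sum>j\<le>Suc M. \<bar>a (s t - j) - w\<bar>)"
      using s(1)[of t] by simp
  qed
  then have "a \<longlonglongrightarrow> w" by (simp add: LIM_zero_iff)
  then show ?thesis
    by (intro small_steps[of "\<lambda>t. t"] LIMSEQ_Suc filterlim_ident)
qed

section \<open>Convergence of the algorithm\<close>

theorem theorem1:
  fixes A :: "real ^ 'n ^ 'm" and C :: "(real ^ 'n) set" and D :: "(real ^ 'm) set"
    and Lmin Lmax \<tau> c :: real and M :: nat and x :: "nat \<Rightarrow> real ^ 'n"
  assumes "closed C" and "C \<noteq> {}" and "closed D" and "D \<noteq> {}"
    and "horizon_cone C \<inter> (\<lambda>z. A *v z) -` horizon_cone D = {0}"
    and "0 < Lmin" and "Lmin \<le> Lmax" and "1 < \<tau>" and "0 < c"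
    and "spfeas_dc_ls A C D Lmin Lmax \<tau> c M x"
  shows "bounded (range x) \<and>
    (\<forall>xstar. (\<exists>r. strict_mono r \<and> (x \<circ> r) \<longlonglongrightarrow> xstar) \<longrightarrow> sf_stationary A C D xstar)"
proof -
  define K where "K = onorm ((*v) A)"
  define b where "b t = infdist (A *v x t) D" for t
  define a where "a t = (b t)\<^sup>2" for t
  define Lsup where "Lsup = max Lmax (\<tau> * (K\<^sup>2 + c))"
  have A_bl: "bounded_linear ((*v) A)" by (rule matrix_vector_mul_bounded_linear)
  have b0: "0 \<le> b t" for t by (simp add: b_def infdist_nonneg)
  have outcome: "\<exists>L \<eta>. 0 < L \<and> L \<le> Lsup \<and> \<eta> \<in> proj_set D (A *v x t) \<and>
      x (Suc t) \<in> proj_set C (x t - (transpose A *v (A *v x t - \<eta>)) /\<^sub>R L) \<and>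
      a (Suc t) \<le> Max (a ` {t - M..t}) - c * (norm (x (Suc t) - x t))\<^sup>2"
    if "x t \<in> C" for t
  proof -
    obtain L0 L where L0: "L0 \<in> {Lmin..Lmax}"
      and ls: "sf_line_search A C D \<tau> c (Max (a ` {t - M..t})) (x t) L0 L (x (Suc t))"
      using assms(10) unfolding spfeas_dc_ls_def a_def b_def by meson
    have R: "(infdist (A *v x t) D)\<^sup>2 \<le> Max (a ` {t - M..t})"
      by (rule Max_ge) (auto simp: a_def b_def)
    have "0 < L0" using L0 assms(6) by auto
    from line_search_outcome[OF ls that R this assms(8)] L0 show ?thesis
      unfolding Lsup_def K_def a_def b_def by fastforce
  qed
  have xC: "x t \<in> C" for t
  proof (induction t)
    case 0
    then show ?case using assms(10) by (simp add: spfeas_dc_ls_def)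
  next
    case (Suc t)
    then show ?case using outcome[OF Suc] by (auto simp: proj_set_iff)
  qed
  obtain L \<eta> where L: "\<And>t. 0 < L t" "\<And>t. L t \<le> Lsup"
    and \<eta>: "\<And>t. \<eta> t \<in> proj_set D (A *v x t)"
    and next_proj: "\<And>t. x (Suc t) \<in> proj_set C (x t - (transpose A *v (A *v x t - \<eta> t)) /\<^sub>R L t)"
    and descent: "\<And>t. a (Suc t) \<le> Max (a ` {t - M..t}) - c * (norm (x (Suc t) - x t))\<^sup>2"
    using outcome[OF xC] by metis

  have "decseq (\<lambda>t. Max (a ` {t - M..t}))"
  proof (rule nonmonotone_window_max_decseq)
    show "a (Suc t) \<le> Max (a ` {t - M..t})" for t
      by (rule order_trans[OF descent]) (use assms(9) in simp)
  qed
  then have "Max (a ` {t - M..t}) \<le> a 0" for t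
    using decseqD[of "\<lambda>t. Max (a ` {t - M..t})" 0 t] by simp
  moreover have "a t \<le> Max (a ` {t - M..t})" for t
    by (rule Max_ge) auto
  ultimately have "a t \<le> a 0" for t
    using order_trans by blast
  then have b_le: "b t \<le> b 0" for t
    unfolding a_def using b0 power2_le_imp_le by blast
  have "bounded {z \<in> C. infdist (A *v z) D \<le> b 0}"
    using assms(3-5) by (intro bounded_sublevel_if_horizon_cones[OF A_bl]) auto
  then have bdd: "bounded (range x)"
    by (rule bounded_subset) (use xC b_le in \<open>auto simp: b_def\<close>)

  (* The distance to D after applying A is K-Lipschitz and at most b 0 along the iterates, so its
     square has Lipschitz constant 2 * b 0 * K there. *)
  have "\<bar>a (Suc t) - a t\<bar> \<le> (2 * b 0 * K) * norm (x (Suc t) - x t)" for t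
  proof -
    have "\<bar>b (Suc t) - b t\<bar> \<le> norm (A *v x (Suc t) - A *v x t)"
      using infdist_triangle_abs[of "A *v x (Suc t)" D "A *v x t"] by (simp add: b_def dist_norm)
    also have "\<dots> \<le> K * norm (x (Suc t) - x t)"
      using onorm[OF A_bl, of "x (Suc t) - x t"]
      by (simp add: K_def matrix_vector_mult_diff_distrib)
    finally have "\<bar>b (Suc t) - b t\<bar> \<le> K * norm (x (Suc t) - x t)" .
    moreover have "\<bar>b (Suc t) + b t\<bar> \<le> 2 * b 0"
      using b_le[of t] b_le[of "Suc t"] b0[of t] b0[of "Suc t"] by simp
    ultimately have "\<bar>b (Suc t) + b t\<bar> * \<bar>b (Suc t) - b t\<bar>
        \<le> (2 * b 0) * (K * norm (x (Suc t) - x t))"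
      using b0[of 0] by (intro mult_mono) auto
    moreover have "a (Suc t) - a t = (b (Suc t) + b t) * (b (Suc t) - b t)"
      by (simp add: a_def power2_eq_square algebra_simps)
    ultimately show ?thesis by (simp add: abs_mult mult.assoc)
  qed
  then have "(\<lambda>t. norm (x (Suc t) - x t)) \<longlonglongrightarrow> 0"
    by (rule nonmonotone_descent_steps_tendsto_0[OF assms(9) _ _ descent, rotated]) (simp add: a_def)
  then have steps: "(\<lambda>t. x (Suc t) - x t) \<longlonglongrightarrow> 0"
    by (rule tendsto_norm_zero_cancel)

  have "bounded (range (\<lambda>t. A *v x t))"
    using bounded_linear_image[OF bdd A_bl] by (simp add: image_image)
  then obtain B where B: "\<And>t. norm (A *v x t) \<le> B" by (auto simp: bounded_iff)
  have "norm (\<eta> t) \<le> B + b 0" for t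
    using norm_triangle_ineq4[of "A *v x t" "A *v x t - \<eta> t"] B[of t] b_le[of t]
      infdist_eq_norm_proj_set[OF \<eta>[of t]] by (simp add: b_def)
  then have \<eta>_bdd: "bounded (range (\<eta> \<circ> r))" for r
    by (auto simp: bounded_iff)

  have "sf_stationary A C D xstar" if r: "strict_mono r" "(x \<circ> r) \<longlonglongrightarrow> xstar"
    for xstar and r :: "nat \<Rightarrow> nat"
  proof -
    obtain \<eta>star q where q: "strict_mono q" and "((\<eta> \<circ> r) \<circ> q) \<longlonglongrightarrow> \<eta>star"
      using bounded_imp_convergent_subsequence[OF \<eta>_bdd] by blast
    define p where "p = r \<circ> q"
    have p: "strict_mono p" unfolding p_def using r(1) q by (rule strict_mono_o)
    have \<eta>_lim: "(\<lambda>k. \<eta> (p k)) \<longlonglongrightarrow> \<eta>star"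
      using \<open>((\<eta> \<circ> r) \<circ> q) \<longlonglongrightarrow> \<eta>star\<close> by (simp add: p_def o_def)
    have x_lim: "(\<lambda>k. x (p k)) \<longlonglongrightarrow> xstar"
      using LIMSEQ_subseq_LIMSEQ[OF r(2) q] by (simp add: p_def o_def)
    have step_lim: "(\<lambda>k. x (Suc (p k)) - x (p k)) \<longlonglongrightarrow> 0"
      using LIMSEQ_subseq_LIMSEQ[OF steps p] by (simp add: o_def)
    have xS_lim: "(\<lambda>k. x (Suc (p k))) \<longlonglongrightarrow> xstar"
      using tendsto_add[OF step_lim x_lim] by simp
    have Ax_lim: "(\<lambda>k. A *v x (p k)) \<longlonglongrightarrow> A *v xstar"
      by (rule bounded_linear.tendsto[OF A_bl x_lim])
    define g where "g k = transpose A *v (A *v x (p k) - \<eta> (p k))" for k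
    define gstar where "gstar = transpose A *v (A *v xstar - \<eta>star)"
    (* The residual of the projection onto C, scaled by the accepted constant: it is a regular normal
       at the new iterate, and the scaling turns its gradient part into exactly - g. *)
    define v where "v k = L (p k) *\<^sub>R (x (p k) - g k /\<^sub>R L (p k) - x (Suc (p k)))" for k
    have "g \<longlonglongrightarrow> gstar"
      unfolding g_def gstar_def
      by (intro bounded_linear.tendsto[OF matrix_vector_mul_bounded_linear] tendsto_diff Ax_lim \<eta>_lim)
    moreover have "(\<lambda>k. L (p k) *\<^sub>R (x (Suc (p k)) - x (p k))) \<longlonglongrightarrow> 0"
    proof (rule Lim_null_comparison)
      show "\<forall>\<^sub>F k in sequentially. norm (L (p k) *\<^sub>R (x (Suc (p k)) - x (p k)))
          \<le> Lsup * norm (x (Suc (p k)) - x (p k))"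
        using L by (auto simp: less_imp_le intro!: always_eventually mult_right_mono)
      show "(\<lambda>k. Lsup * norm (x (Suc (p k)) - x (p k))) \<longlonglongrightarrow> 0"
        using step_lim by (intro tendsto_mult_right_zero tendsto_norm_zero)
    qed
    ultimately have "(\<lambda>k. - (L (p k) *\<^sub>R (x (Suc (p k)) - x (p k))) - g k) \<longlonglongrightarrow> - 0 - gstar"
      by (intro tendsto_intros)
    moreover have "v = (\<lambda>k. - (L (p k) *\<^sub>R (x (Suc (p k)) - x (p k))) - g k)"
    proof
      show "v k = - (L (p k) *\<^sub>R (x (Suc (p k)) - x (p k))) - g k" for k
        using L(1)[of "p k"] by (simp add: v_def scaleR_diff_right)
    qed
    ultimately have v_lim: "v \<longlonglongrightarrow> - gstar" by simp
    have v_normal: "v k \<in> regular_subdifferential (indicator_fun C) (x (Suc (p k)))" for k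
      unfolding v_def g_def
      using L(1) by (intro proximal_normal_in_regular_subdifferential next_proj) (simp add: less_imp_le)
    have "xstar \<in> C"
      by (rule closed_sequentially[OF assms(1) _ xS_lim]) (use xC in simp)
    then have "- gstar \<in> limiting_normal_cone C xstar"
      unfolding limiting_normal_cone_def limiting_subdifferential_def
    proof (intro CollectI conjI exI allI)
      show "(\<lambda>k. x (Suc (p k))) \<longlonglongrightarrow> xstar" "v \<longlonglongrightarrow> - gstar" by fact+
      show "v k \<in> regular_subdifferential (indicator_fun C) (x (Suc (p k)))" for k by fact
    qed (use \<open>xstar \<in> C\<close> xC in \<open>simp_all add: indicator_fun_def\<close>)
    moreover have "\<eta>star \<in> proj_set D (A *v xstar)"
      using proj_set_closed_graph[OF assms(3) \<eta> Ax_lim \<eta>_lim] .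
    moreover have "0 = transpose A *v (A *v xstar) - transpose A *v \<eta>star + - gstar"
      by (simp add: gstar_def matrix_vector_mult_diff_distrib)
    ultimately show ?thesis unfolding sf_stationary_def by blast
  qed
  with bdd show ?thesis by blast
qed

end
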